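(* Let $n\ge1$ be an integer, and let $H_n$, $\langle-,-\rangle$ and $L$ be as defined in the context. Then: (a) (Poincaré duality) $\langle-,-\rangle:H_n\times H_n\to\mathbb{R}$ is an $S_n$-equivariant graded bilinear form, which is non-degenerate. (b) (Hard Lefschetz) $L:H_n^{i}\to H_n^{i+2}$ is $S_n$-equivariant and satisfies the hard Lefschetz theorem, i.e., for all $i\ge0$, $L^i:H_n^{-i}\to H_n^{i}$ is an isomorphism.
   Context: Let $V$ be a real vector space with basis $\theta_1,\dots,\theta_n$ and $V^*$ its dual with dual basis $\xi_1,\dots,\xi_n$. Let $\Lambda^j=\Lambda^j(V)$ and $(\Lambda^* )^k=\Lambda^k(V^* )$. Put $H_n=\bigoplus_{i=0}^{2n}H_n^{-n+i}$ with $H_n^{-n+i}:=\bigoplus_{j+k=i}\Lambda^j\otimes(\Lambda^* )^k$ (other graded pieces are $0$). $S_n$ acts by permuting the indices of the $\theta_k$ and of the $\xi_k$, hence on exterior powers and on $H_n$. The graded pairing $\langle-,-\rangle$ is defined by the multiplication map $H_n^{-n+i}\otimes H_n^{n-i}\to H_n^n\cong\mathbb{R}$, where multiplication is $(u\otimes v)(u'\otimes v')=(u\wedge u')\otimes(v\wedge v')$ and the isomorphism $H_n^n\cong\mathbb{R}$ sends $\theta_1\wedge\dots\wedge\theta_n\otimes\xi_1\wedge\dots\wedge\xi_n$ to $1$; it is set to $0$ on $H_n^i\times H_n^j$ for $i\neq -j$ (this is what graded means). The operator is $L:=\sum_{k=1}^n e_{\theta_k}\otimes e_{\xi_k}$,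 i.e. $L(u\otimes v)=\sum_k(\theta_k\wedge u)\otimes(\xi_k\wedge v)$. A bilinear form is $S_n$-equivariant if $\langle\sigma a,\sigma b\rangle=\langle a,b\rangle$ for all $\sigma\in S_n$; an operator is $S_n$-equivariant if it commutes with $S_n$. *)

theory Defs
  imports "HOL-Analysis.Analysis" "HOL-Combinatorics.Permutations"
begin

section \<open>Exterior algebra on generators indexed by a finite linear order\<close>

text \<open>
  The coordinate at \<open>A = {a\<^sub>1 < ... < a\<^sub>j}\<close> belongs to the basis vector
  \<open>\<theta>\<^bsub>a\<^sub>1\<^esub> \<and> ... \<and> \<theta>\<^bsub>a\<^sub>j\<^esub>\<close>. The same type, with \<open>\<xi>\<close> in place of \<open>\<theta>\<close>, serves for the
  exterior algebra of the dual space. The lemmas of this section show that \<open>wedge\<close> is associative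
  and unital with alternating generators, that \<open>ext_basis A\<close> is the ordered product of its generators,
  and that the universal property of the exterior algebra holds.
\<close>

type_synonym 'n ext = "(real, 'n set) vec"

definition ext_basis :: "'n::finite set \<Rightarrow> 'n ext" where
  "ext_basis A = axis A 1"

abbreviation gen :: "'n::finite \<Rightarrow> 'n ext" where
  "gen k \<equiv> ext_basis {k}"

definition crossings :: "'n::linorder set \<Rightarrow> 'n set \<Rightarrow> nat" where
  "crossings A B = card {(a, b). a \<in> A \<and> b \<in> B \<and> b < a}"

text \<open>Sorting the concatenation of the increasing words of \<open>A\<close> and \<open>B\<close> takes
  \<open>crossings A B\<close> transpositions of neighbours.\<close>

definition ext_basis_wedge :: "'n::{finite,linorder} set \<Rightarrow> 'n set \<Rightarrow> 'n ext" where
  "ext_basis_wedge A B =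
     (if A \<inter> B = {} then (- 1) ^ crossings A B *\<^sub>R ext_basis (A \<union> B) else 0)"

definition wedge :: "'n::{finite,linorder} ext \<Rightarrow> 'n ext \<Rightarrow> 'n ext" where
  "wedge u v = (\<Sum>A\<in>UNIV. \<Sum>B\<in>UNIV. (u $ A * v $ B) *\<^sub>R ext_basis_wedge A B)"

definition wedge_list :: "'n::{finite,linorder} ext list \<Rightarrow> 'n ext" where
  "wedge_list us = foldr wedge us (ext_basis {})"

definition ext_pow :: "nat \<Rightarrow> 'n::finite ext set" where
  "ext_pow j = span {ext_basis A |A. card A = j}"

definition ext_perm :: "('n \<Rightarrow> 'n) \<Rightarrow> 'n::{finite,linorder} ext \<Rightarrow> 'n ext" where
  "ext_perm p u =
     (\<Sum>A\<in>UNIV. u $ A *\<^sub>R wedge_list (map (\<lambda>k. gen (p k)) (sorted_list_of_set A)))"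

lemma ext_basis_nth: "ext_basis A $ B = (if A = B then 1 else 0)"
  by (simp add: ext_basis_def axis_def)

lemma ext_basis_expansion: "u = (\<Sum>A\<in>UNIV. u $ A *\<^sub>R ext_basis A)"
  by (simp add: vec_eq_iff ext_basis_nth if_distrib cong: if_cong)

lemma bilinear_wedge: "bilinear wedge"
  unfolding bilinear_def wedge_def
  by (auto intro!: linearI simp: algebra_simps sum.distrib scaleR_sum_right)

lemma wedge_ext_basis: "wedge (ext_basis A) (ext_basis B) = ext_basis_wedge A B"
  by (simp add: wedge_def ext_basis_nth if_distrib[of "\<lambda>c. c * _"] if_distrib[of "\<lambda>c. c *\<^sub>R _"]
      sum.If_cases cong: if_cong)

lemma bilinear_sum_scaleR:
  fixes f :: "'a::real_vector \<Rightarrow> 'b::real_vector \<Rightarrow> 'c::real_vector"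
  assumes "bilinear f"
  shows "f (\<Sum>i\<in>I. a i *\<^sub>R x i) (\<Sum>j\<in>J. b j *\<^sub>R y j)
       = (\<Sum>i\<in>I. \<Sum>j\<in>J. (a i * b j) *\<^sub>R f (x i) (y j))"
proof -
  have l: "linear (\<lambda>x. f x y)" "linear (f x)" for x y
    using assms by (auto simp: bilinear_def)
  have 1: "f (\<Sum>i\<in>I. a i *\<^sub>R x i) w = (\<Sum>i\<in>I. a i *\<^sub>R f (x i) w)" for w
    using linear_sum[OF l(1), of "\<lambda>i. a i *\<^sub>R x i" I w] linear_scale[OF l(1)] by simp
  have 2: "f z (\<Sum>j\<in>J. b j *\<^sub>R y j) = (\<Sum>j\<in>J. b j *\<^sub>R f z (y j))" for z
    using linear_sum[OF l(2), of z "\<lambda>j. b j *\<^sub>R y j" J] linear_scale[OF l(2)] by simp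
  show ?thesis unfolding 1 unfolding 2 by (simp add: scaleR_sum_right)
qed

lemma crossings_Un_left:
  fixes A B C :: "'n::{finite,linorder} set"
  assumes "A \<inter> B = {}"
  shows "crossings (A \<union> B) C = crossings A C + crossings B C"
  unfolding crossings_def using assms
  by (subst card_Un_disjoint[symmetric]) (auto intro: arg_cong[where f = card])

lemma crossings_Un_right:
  fixes A B C :: "'n::{finite,linorder} set"
  assumes "B \<inter> C = {}"
  shows "crossings A (B \<union> C) = crossings A B + crossings A C"
  unfolding crossings_def using assms
  by (subst card_Un_disjoint[symmetric]) (auto intro: arg_cong[where f = card])

lemma linear_wedge: "linear (wedge u)" "linear (\<lambda>u. wedge u v)"
  using bilinear_wedge by (auto simp: bilinear_def)

lemma wedge_simps:
  "wedge (c *\<^sub>R u) v = c *\<^sub>R wedge u v" "wedge u (c *\<^sub>R v) = c *\<^sub>R wedge u v"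
  "wedge 0 v = 0" "wedge u 0 = 0"
  using linear_scale[OF linear_wedge(1)] linear_scale[OF linear_wedge(2)]
    linear_0[OF linear_wedge(1)] linear_0[OF linear_wedge(2)] by auto

lemma wedge_ext_basis_assoc:
  "wedge (wedge (ext_basis A) (ext_basis B)) (ext_basis C) = wedge (ext_basis A) (wedge (ext_basis B) (ext_basis C))"
  by (cases "A \<inter> B = {}"; cases "B \<inter> C = {}"; cases "A \<inter> C = {}")
    (auto simp: wedge_ext_basis ext_basis_wedge_def wedge_simps crossings_Un_left crossings_Un_right
      Int_Un_distrib Int_Un_distrib2 Un_assoc power_add mult.assoc)

lemma linear_eq_on_ext_basis:
  fixes f g :: "'n::finite ext \<Rightarrow> 'b::real_vector"
  assumes "linear f" "linear g" "\<And>A. f (ext_basis A) = g (ext_basis A)"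
  shows "f u = g u"
proof -
  have "h u = (\<Sum>A\<in>UNIV. u $ A *\<^sub>R h (ext_basis A))" if "linear h" for h :: "'n ext \<Rightarrow> 'b"
    by (subst ext_basis_expansion[of u]) (simp add: linear_sum[OF that] linear_scale[OF that])
  from this[OF assms(1)] this[OF assms(2)] show ?thesis by (simp only: assms(3))
qed

lemma wedge_assoc: "wedge (wedge u v) w = wedge u (wedge v w)"
proof -
  note l = linear_wedge linear_compose[OF linear_wedge(1) linear_wedge(1), unfolded o_def]
    linear_compose[OF linear_wedge(1) linear_wedge(2), unfolded o_def]
    linear_compose[OF linear_wedge(2) linear_wedge(1), unfolded o_def]
    linear_compose[OF linear_wedge(2) linear_wedge(2), unfolded o_def]
  have "wedge (wedge (ext_basis A) (ext_basis B)) w = wedge (ext_basis A) (wedge (ext_basis B) w)" for A B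
    by (rule linear_eq_on_ext_basis[of _ _ w]) (auto intro: l wedge_ext_basis_assoc)
  then have "wedge (wedge (ext_basis A) v) w = wedge (ext_basis A) (wedge v w)" for A
    by (intro linear_eq_on_ext_basis[where f = "\<lambda>v. wedge (wedge (ext_basis A) v) w" and u = v]) (auto intro: l)
  then show ?thesis
    by (intro linear_eq_on_ext_basis[where f = "\<lambda>u. wedge (wedge u v) w" and u = u]) (auto intro: l)
qed

lemma wedge_one: "wedge (ext_basis {}) u = u" "wedge u (ext_basis {}) = u"
  by (rule linear_eq_on_ext_basis[of _ "\<lambda>u. u" u];
      simp add: linear_wedge wedge_ext_basis ext_basis_wedge_def crossings_def linear_id[unfolded id_def])+

lemma wedge_gen_self: "wedge (gen i) (gen i) = 0"
  by (simp add: wedge_ext_basis ext_basis_wedge_def)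

lemma wedge_gen_anticommute: "wedge (gen i) (gen j) = - wedge (gen j) (gen i)"
proof -
  have "crossings {i} {j} = (if j < i then 1 else 0)" for i j :: 'a
    by (auto simp: crossings_def intro: card_eq_0_iff[THEN iffD2])
      (rule card_1_singleton_iff[THEN iffD2], auto)
  then show ?thesis
    by (cases i j rule: linorder_cases) (auto simp: wedge_ext_basis ext_basis_wedge_def insert_commute)
qed

lemma sorted_list_of_set_insert_min:
  fixes A :: "'n::{finite,linorder} set"
  assumes "\<forall>b\<in>A. a < b"
  shows "sorted_list_of_set (insert a A) = a # sorted_list_of_set A"
proof -
  have "\<forall>x\<in>set (sorted_list_of_set A). a \<le> x" "a \<notin> A"
    using assms by (auto simp: less_imp_le)
  then show ?thesis by (simp add: insort_is_Cons)
qed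

lemma wedge_gen_min:
  assumes "\<forall>b\<in>A. a < b"
  shows "wedge (gen a) (ext_basis A) = ext_basis (insert a A)"
proof -
  have "{(a', b). a' \<in> {a} \<and> b \<in> A \<and> b < a'} = {}" "a \<notin> A"
    using assms by auto
  moreover from this have "crossings {a} A = 0"
    unfolding crossings_def by (simp only: card.empty)
  ultimately show ?thesis by (simp add: wedge_ext_basis ext_basis_wedge_def)
qed

lemma wedge_list_gen_sorted: "wedge_list (map gen (sorted_list_of_set A)) = ext_basis A"
proof (induction A rule: finite_linorder_min_induct[OF finite])
  case 1
  show ?case by (simp add: wedge_list_def)
next
  case (2 a A)
  then show ?case
    by (simp add: sorted_list_of_set_insert_min wedge_list_def wedge_gen_min
        del: sorted_list_of_set_insert_remove)
qed

text \<open>Universal property: alternating generators in any associative unital algebra (given by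
  a bilinear \<open>m\<close> with unit \<open>e\<close>) extend to an algebra homomorphism.\<close>

context
  fixes m :: "'b::real_vector \<Rightarrow> 'b \<Rightarrow> 'b" and e :: 'b and f :: "'n::{finite,linorder} \<Rightarrow> 'b"
  assumes m: "bilinear m" and assoc: "\<And>x y z. m (m x y) z = m x (m y z)"
    and unit: "\<And>x. m e x = x" "\<And>x. m x e = x"
    and alt: "\<And>i. m (f i) (f i) = 0" and anti: "\<And>i j. m (f i) (f j) = - m (f j) (f i)"
begin

definition ext_lift :: "'n ext \<Rightarrow> 'b" where
  "ext_lift u = (\<Sum>A\<in>UNIV. u $ A *\<^sub>R foldr m (map f (sorted_list_of_set A)) e)"

lemma linear_ext_lift: "linear ext_lift"
  unfolding ext_lift_def by (auto intro!: linearI simp: algebra_simps sum.distrib scaleR_sum_right)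

lemma ext_lift_ext_basis: "ext_lift (ext_basis A) = foldr m (map f (sorted_list_of_set A)) e"
  by (simp add: ext_lift_def ext_basis_nth if_distrib[of "\<lambda>c. c *\<^sub>R _"] cong: if_cong)

lemma ext_lift_one: "ext_lift (ext_basis {}) = e"
  by (simp add: ext_lift_ext_basis)

lemma ext_lift_gen: "ext_lift (gen i) = f i"
  by (simp add: ext_lift_ext_basis unit)

lemma m_simps: "m (c *\<^sub>R x) y = c *\<^sub>R m x y" "m x (c *\<^sub>R y) = c *\<^sub>R m x y"
  "m 0 y = 0" "m x 0 = 0" "m (- x) y = - m x y" "m x (- y) = - m x y"
  using bilinear_lmul[OF m] bilinear_rmul[OF m] bilinear_lzero[OF m] bilinear_rzero[OF m]
    bilinear_lneg[OF m] bilinear_rneg[OF m] by auto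

lemma ext_lift_min:
  assumes "\<forall>b\<in>A. a < b"
  shows "ext_lift (ext_basis (insert a A)) = m (f a) (ext_lift (ext_basis A))"
  by (simp add: ext_lift_ext_basis sorted_list_of_set_insert_min[OF assms])

lemma ext_lift_gen_ext_basis:
  "m (f a) (ext_lift (ext_basis B)) = ext_lift (wedge (gen a) (ext_basis B))"
proof (induction B rule: finite_linorder_min_induct[OF finite])
  case 1
  show ?case by (simp add: ext_lift_one ext_lift_gen unit wedge_one)
next
  case (2 b B)
  have b: "m (f b) (ext_lift (ext_basis B)) = ext_lift (ext_basis (insert b B))"
    "wedge (gen b) (ext_basis B) = ext_basis (insert b B)"
    using 2 by (simp_all add: ext_lift_min wedge_gen_min)
  consider "a < b" | "a = b" | "b < a" by (rule linorder_cases)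
  then show ?case
  proof cases
    case 1
    then have *: "\<forall>x\<in>insert b B. a < x" using 2 by auto
    then show ?thesis
      by (simp only: ext_lift_min[OF *] wedge_gen_min[OF *])
  next
    case 2
    then have "m (f a) (ext_lift (ext_basis (insert b B))) = m (m (f a) (f a)) (ext_lift (ext_basis B))"
      by (simp add: b(1)[symmetric] assoc)
    also have "\<dots> = 0" by (simp add: alt m_simps)
    finally show ?thesis
      using 2 by (simp add: wedge_ext_basis ext_basis_wedge_def linear_0[OF linear_ext_lift])
  next
    case 3
    have "m (f a) (ext_lift (ext_basis (insert b B))) = - m (f b) (m (f a) (ext_lift (ext_basis B)))"
      by (simp add: b(1)[symmetric] assoc[symmetric] anti[of a b] m_simps)
    also have "\<dots> = - m (f b) (ext_lift (wedge (gen a) (ext_basis B)))"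
      using 2 by simp
    also have "\<dots> = - ext_lift (wedge (gen b) (wedge (gen a) (ext_basis B)))"
    proof (cases "a \<in> B")
      case True
      then show ?thesis
        by (simp add: wedge_ext_basis ext_basis_wedge_def linear_0[OF linear_ext_lift] m_simps wedge_simps)
    next
      case False
      have *: "\<forall>x\<in>insert a B. b < x" using 2 3 by auto
      then show ?thesis
        using False ext_lift_min[OF *] wedge_ext_basis[of "{a}" B] wedge_gen_min[OF *]
        by (simp add: ext_basis_wedge_def linear_scale[OF linear_ext_lift] m_simps wedge_simps)
    qed
    also have "\<dots> = ext_lift (wedge (gen a) (wedge (gen b) (ext_basis B)))"
      by (simp add: wedge_assoc[symmetric] wedge_gen_anticommute[of a b]
          linear_neg[OF linear_wedge(2)] linear_neg[OF linear_ext_lift])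
    finally show ?thesis by (simp add: b(2))
  qed
qed

lemma ext_lift_gen_wedge: "m (f a) (ext_lift v) = ext_lift (wedge (gen a) v)"
proof -
  have "linear (m (f a))" using m by (simp add: bilinear_def)
  then have "linear (\<lambda>v. m (f a) (ext_lift v))"
    using linear_compose[OF linear_ext_lift] by (simp add: o_def)
  moreover have "linear (\<lambda>v. ext_lift (wedge (gen a) v))"
    using linear_compose[OF linear_wedge(1) linear_ext_lift] by (simp add: o_def)
  ultimately show ?thesis by (rule linear_eq_on_ext_basis) (rule ext_lift_gen_ext_basis)
qed

lemma ext_lift_wedge: "ext_lift (wedge u v) = m (ext_lift u) (ext_lift v)"
proof -
  have *: "ext_lift (wedge (ext_basis A) v) = m (ext_lift (ext_basis A)) (ext_lift v)" for A
  proof (induction A rule: finite_linorder_min_induct[OF finite])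
    case 1
    show ?case by (simp add: ext_lift_one unit wedge_one)
  next
    case (2 a A)
    then have "ext_basis (insert a A) = wedge (gen a) (ext_basis A)"
      by (simp add: wedge_gen_min)
    then show ?case
      using 2 by (simp add: wedge_assoc ext_lift_gen_wedge[symmetric] assoc)
  qed
  have "linear (\<lambda>x. m x (ext_lift v))" using m by (simp add: bilinear_def)
  then have "linear (\<lambda>u. m (ext_lift u) (ext_lift v))"
    using linear_compose[OF linear_ext_lift] by (simp add: o_def)
  with linear_compose[OF linear_wedge(2) linear_ext_lift, unfolded o_def]
  show ?thesis by (rule linear_eq_on_ext_basis) (rule *)
qed

lemma ext_lift_unique:
  assumes "linear g" "g (ext_basis {}) = e" "\<And>i. g (gen i) = f i"
    and "\<And>u v. g (wedge u v) = m (g u) (g v)"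
  shows "g = ext_lift"
proof -
  have "g (wedge_list (map gen xs)) = foldr m (map f xs) e" for xs
    by (induction xs) (simp_all add: wedge_list_def assms)
  then have "g (ext_basis A) = ext_lift (ext_basis A)" for A
    by (metis ext_lift_ext_basis wedge_list_gen_sorted)
  then show ?thesis
    using linear_eq_on_ext_basis[OF assms(1) linear_ext_lift] by blast
qed

end

lemma ext_perm_wedge: "ext_perm p (wedge u v) = wedge (ext_perm p u) (ext_perm p v)"
proof -
  note wedge_alg = bilinear_wedge wedge_assoc wedge_one wedge_gen_self wedge_gen_anticommute
  have "ext_perm p u = ext_lift wedge (ext_basis {}) (\<lambda>k. gen (p k)) u" for u
    unfolding ext_lift_def[OF wedge_alg] by (simp add: ext_perm_def wedge_list_def)
  then show ?thesis by (simp add: ext_lift_wedge[OF wedge_alg])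
qed

lemma ext_perm_gen: "ext_perm p (gen k) = gen (p k)"
  by (simp add: ext_perm_def ext_basis_nth wedge_list_def wedge_one if_distrib[of "\<lambda>c. c *\<^sub>R _"]
      cong: if_cong)


section \<open>The bigraded algebra \<open>H\<^sub>n\<close>\<close>

text \<open>\<open>H\<^sub>n\<close> with \<open>n = CARD('n)\<close> is the tensor product of the two exterior algebras: the coordinate
  at \<open>(A, B)\<close> belongs to \<open>\<theta>\<^sub>A \<otimes> \<xi>\<^sub>B\<close>.\<close>

type_synonym 'n super = "(real, 'n set \<times> 'n set) vec"

definition tens :: "'n::finite ext \<Rightarrow> 'n ext \<Rightarrow> 'n super" where
  "tens u v = (\<chi> AB. u $ fst AB * v $ snd AB)"

text \<open>Multiplication: the bilinear extension of \<open>(u \<otimes> v)(u' \<otimes> v') = (u \<and> u') \<otimes> (v \<and> v')\<close>,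
  with no additional sign.\<close>

definition super_mult :: "'n::{finite,linorder} super \<Rightarrow> 'n super \<Rightarrow> 'n super" where
  "super_mult x y = (\<Sum>(A, B)\<in>UNIV. \<Sum>(A', B')\<in>UNIV.
     (x $ (A, B) * y $ (A', B')) *\<^sub>R
       tens (wedge (ext_basis A) (ext_basis A')) (wedge (ext_basis B) (ext_basis B')))"

definition tens_map ::
    "('n ext \<Rightarrow> 'n ext) \<Rightarrow> ('n ext \<Rightarrow> 'n ext) \<Rightarrow> 'n::finite super \<Rightarrow> 'n super" where
  "tens_map f g x = (\<Sum>(A, B)\<in>UNIV. x $ (A, B) *\<^sub>R tens (f (ext_basis A)) (g (ext_basis B)))"

definition super_piece :: "int \<Rightarrow> 'n::finite super set" where
  "super_piece d = span {tens u v |u v j k.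
     u \<in> ext_pow j \<and> v \<in> ext_pow k \<and> - int CARD('n) + int (j + k) = d}"

definition super_component :: "int \<Rightarrow> 'n::finite super \<Rightarrow> 'n super" where
  "super_component d x =
     (\<chi> AB. if - int CARD('n) + int (card (fst AB) + card (snd AB)) = d then x $ AB else 0)"

text \<open>The isomorphism from the top degree piece to the reals reads off the coefficient of
  \<open>\<theta>\<^sub>1 \<and> ... \<and> \<theta>\<^sub>n \<otimes> \<xi>\<^sub>1 \<and> ... \<and> \<xi>\<^sub>n\<close>.\<close>

definition top_coeff :: "'n::finite super \<Rightarrow> real" where
  "top_coeff z = z $ (UNIV, UNIV)"

definition pairing :: "'n::{finite,linorder} super \<Rightarrow> 'n super \<Rightarrow> real" where
  "pairing x y = (\<Sum>d = - int CARD('n)..int CARD('n).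
     top_coeff (super_mult (super_component d x) (super_component (- d) y)))"

definition super_perm :: "('n \<Rightarrow> 'n) \<Rightarrow> 'n::{finite,linorder} super \<Rightarrow> 'n super" where
  "super_perm p = tens_map (ext_perm p) (ext_perm p)"

definition lefschetz :: "'n::{finite,linorder} super \<Rightarrow> 'n super" where
  "lefschetz x = (\<Sum>k\<in>UNIV. tens_map (wedge (gen k)) (wedge (gen k)) x)"

lemma bilinear_tens: "bilinear tens"
  unfolding bilinear_def tens_def by (auto intro!: linearI simp: vec_eq_iff algebra_simps)

lemma tens_nth: "tens u v $ (A, B) = u $ A * v $ B"
  by (simp add: tens_def)

lemma sum_UNIV_prod: "(\<Sum>p\<in>UNIV. g p) = (\<Sum>a\<in>UNIV. \<Sum>b\<in>UNIV. g (a, b))"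
  by (simp add: sum.cartesian_product)

lemma tens_map_tens:
  assumes "linear f" "linear g"
  shows "tens_map f g (tens u v) = tens (f u) (g v)"
proof -
  have "f u = (\<Sum>A\<in>UNIV. u $ A *\<^sub>R f (ext_basis A))"
    by (subst ext_basis_expansion[of u]) (simp add: linear_sum[OF assms(1)] linear_scale[OF assms(1)])
  moreover have "g v = (\<Sum>B\<in>UNIV. v $ B *\<^sub>R g (ext_basis B))"
    by (subst ext_basis_expansion[of v]) (simp add: linear_sum[OF assms(2)] linear_scale[OF assms(2)])
  ultimately show ?thesis
    by (simp add: bilinear_sum_scaleR[OF bilinear_tens] tens_map_def sum_UNIV_prod tens_nth)
qed

lemma lefschetz_tens: "lefschetz (tens u v) = (\<Sum>k\<in>UNIV. tens (wedge (gen k) u) (wedge (gen k) v))"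
  by (simp add: lefschetz_def tens_map_tens linear_wedge)

lemma super_mult_tens: "super_mult (tens u v) (tens u' v') = tens (wedge u u') (wedge v v')"
proof -
  have "tens (wedge u u') (wedge v v') = (\<Sum>A\<in>UNIV. \<Sum>A'\<in>UNIV. \<Sum>B\<in>UNIV. \<Sum>B'\<in>UNIV.
      (u $ A * u' $ A' * (v $ B * v' $ B')) *\<^sub>R tens (ext_basis_wedge A A') (ext_basis_wedge B B'))"
    using bilinear_sum_scaleR[OF bilinear_tens,
        of "\<lambda>p. u $ fst p * u' $ snd p" "\<lambda>p. ext_basis_wedge (fst p) (snd p)" UNIV
          "\<lambda>q. v $ fst q * v' $ snd q" "\<lambda>q. ext_basis_wedge (fst q) (snd q)" UNIV]
    by (simp add: wedge_def sum_UNIV_prod)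
  also have "\<dots> = (\<Sum>A\<in>UNIV. \<Sum>B\<in>UNIV. \<Sum>A'\<in>UNIV. \<Sum>B'\<in>UNIV.
      (u $ A * u' $ A' * (v $ B * v' $ B')) *\<^sub>R tens (ext_basis_wedge A A') (ext_basis_wedge B B'))"
    by (rule sum.cong[OF refl], rule sum.swap)
  also have "\<dots> = super_mult (tens u v) (tens u' v')"
    by (simp add: super_mult_def wedge_ext_basis tens_nth sum_UNIV_prod mult_ac)
  finally show ?thesis by simp
qed

lemma ext_pow_eq: "ext_pow j = {u. \<forall>A. u $ A \<noteq> 0 \<longrightarrow> card A = j}"
proof (intro equalityI subsetI)
  fix u :: "'a ext"
  assume "u \<in> ext_pow j"
  moreover have "subspace {u :: 'a ext. \<forall>A. u $ A \<noteq> 0 \<longrightarrow> card A = j}"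
    by (auto simp: subspace_def) (metis add.right_neutral)
  moreover have "{ext_basis A |A. card A = j} \<subseteq> {u. \<forall>A. u $ A \<noteq> 0 \<longrightarrow> card A = j}"
    by (auto simp: ext_basis_nth split: if_splits)
  ultimately show "u \<in> {u. \<forall>A. u $ A \<noteq> 0 \<longrightarrow> card A = j}"
    unfolding ext_pow_def using span_minimal by blast
next
  fix u :: "'a ext"
  assume u: "u \<in> {u. \<forall>A. u $ A \<noteq> 0 \<longrightarrow> card A = j}"
  have "(\<Sum>A\<in>UNIV. u $ A *\<^sub>R ext_basis A) \<in> ext_pow j"
    unfolding ext_pow_def
  proof (intro span_sum)
    fix A :: "'a set"
    show "u $ A *\<^sub>R ext_basis A \<in> span {ext_basis A |A. card A = j}"
    proof (cases "u $ A = 0")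
      case False
      then have "card A = j" using u by blast
      then show ?thesis by (intro span_scale span_base) blast
    qed (simp add: span_zero)
  qed
  then show "u \<in> ext_pow j" using ext_basis_expansion[of u] by simp
qed

lemma super_expansion:
  "x = (\<Sum>A\<in>UNIV. \<Sum>B\<in>UNIV. x $ (A, B) *\<^sub>R tens (ext_basis A) (ext_basis B))"
  by (simp add: vec_eq_iff tens_nth ext_basis_nth if_distrib[of "\<lambda>c. _ * c"]
      if_distrib[of "\<lambda>c. c * _"] cong: if_cong)

lemma super_piece_iff:
  fixes x :: "'n::finite super"
  shows "x \<in> super_piece d \<longleftrightarrow>
    (\<forall>A B. x $ (A, B) \<noteq> 0 \<longrightarrow> - int CARD('n) + int (card A + card B) = d)"
    (is "_ \<longleftrightarrow> ?P x")
proof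
  assume "x \<in> super_piece d"
  moreover have "subspace (Collect ?P)"
    by (auto simp: subspace_def) (metis add.right_neutral)
  moreover have "{tens u v |u v j k. u \<in> ext_pow j \<and> v \<in> ext_pow k \<and>
      - int CARD('n) + int (j + k) = d} \<subseteq> Collect ?P"
    by (auto simp: ext_pow_eq tens_nth)
  ultimately show "?P x"
    unfolding super_piece_def using span_minimal by blast
next
  assume x: "?P x"
  have "(\<Sum>A\<in>UNIV. \<Sum>B\<in>UNIV. x $ (A, B) *\<^sub>R tens (ext_basis A) (ext_basis B)) \<in> super_piece d"
    unfolding super_piece_def
  proof (intro span_sum)
    fix A B :: "'n set"
    let ?S = "{tens u v |u v j k. u \<in> ext_pow j \<and> v \<in> ext_pow k \<and>
      - int CARD('n) + int (j + k) = d} :: 'n super set"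
    show "x $ (A, B) *\<^sub>R tens (ext_basis A) (ext_basis B) \<in> span ?S"
    proof (cases "x $ (A, B) = 0")
      case False
      then have "- int CARD('n) + int (card A + card B) = d" using x by blast
      moreover have "ext_basis A \<in> ext_pow (card A)" "ext_basis B \<in> ext_pow (card B)"
        by (auto simp: ext_pow_eq ext_basis_nth split: if_splits)
      ultimately have "tens (ext_basis A) (ext_basis B) \<in> ?S" by blast
      then show ?thesis by (intro span_scale span_base)
    qed (simp add: span_zero)
  qed
  then show "x \<in> super_piece d" using super_expansion[of x] by simp
qed

lemma super_component_in_piece: "super_component d x \<in> super_piece d"
  by (simp add: super_piece_iff super_component_def)

lemma super_component_of_piece:
  "x \<in> super_piece d \<Longrightarrow> super_component d' x = (if d' = d then x else 0)"
  by (auto simp: super_piece_iff super_component_def vec_eq_iff)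

lemma sum_super_component:
  fixes x :: "'n::finite super"
  shows "x = (\<Sum>d = - int CARD('n)..int CARD('n). super_component d x)"
proof -
  have "- int CARD('n) + int (card A + card B) \<in> {- int CARD('n)..int CARD('n)}"
    for A B :: "'n set"
    using card_mono[of UNIV A] card_mono[of UNIV B] by simp
  then show ?thesis
    by (simp add: vec_eq_iff super_component_def)
qed

end

theory Submission
  imports Defs
begin

text \<open>
  \<^emph>\<open>Poincare duality.\<close> The product of \<open>\<theta>\<^sub>A \<otimes> \<xi>\<^sub>B\<close> and \<open>\<theta>\<^bsub>A'\<^esub> \<otimes> \<xi>\<^bsub>B'\<^esub>\<close> has a top coefficient only when
  \<open>A'\<close> and \<open>B'\<close> are the complements of \<open>A\<close> and \<open>B\<close>, and then it is a sign. So up to signs the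
  basis is dual to its own rearrangement by complements (\<open>top_coeff_super_mult\<close>), which gives
  bilinearity, the grading and non-degeneracy at once. A permutation acts by algebra automorphisms
  and multiplies both \<open>\<theta>\<^sub>1 \<and> \<dots> \<and> \<theta>\<^sub>n\<close> and \<open>\<xi>\<^sub>1 \<and> \<dots> \<and> \<xi>\<^sub>n\<close> by its sign; the two signs cancel, so the
  pairing is invariant.

  \<^emph>\<open>Hard Lefschetz.\<close> The operator \<open>L\<close> is the raising operator of an \<open>sl\<^sub>2\<close>-triple. The lowering
  operator is \<open>D = \<Sum>\<^sub>k c\<^sub>k \<otimes> c\<^sub>k\<close>, where \<open>c\<^sub>k\<close> is contraction with the \<open>k\<close>-th generator. Contraction
  and multiplication satisfy \<open>c\<^sub>l e\<^sub>k + e\<^sub>k c\<^sub>l = \<delta>\<^bsub>kl\<^esub>\<close>. Hence for \<open>k \<noteq> l\<close> the terms \<open>e\<^sub>k \<otimes> e\<^sub>k\<close> and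
  \<open>c\<^sub>l \<otimes> c\<^sub>l\<close> commute, as the two minus signs cancel; for \<open>k = l\<close>, with \<open>P\<^sub>k = e\<^sub>k c\<^sub>k\<close> the projection to
  the basis vectors that contain \<open>k\<close>, their commutator is
  \<open>P\<^sub>k \<otimes> P\<^sub>k - (1 - P\<^sub>k) \<otimes> (1 - P\<^sub>k) = P\<^sub>k \<otimes> 1 + 1 \<otimes> P\<^sub>k - 1\<close>. Summed over \<open>k\<close> this gives
  \<open>LD - DL = d\<close> on the piece of degree \<open>d\<close> (\<open>lefschetz_commutator\<close>).

  Iterating, \<open>D L\<^bsup>r+1\<^esup> x = L\<^bsup>r+1\<^esup> D x - (r + 1)(d + r) L\<^sup>r x\<close> for \<open>x\<close> of degree \<open>d\<close>. Now let \<open>L\<^sup>r x = 0\<close>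
  with \<open>d \<le> -r\<close>. Then \<open>L\<^bsup>r+1\<^esup> x\<close> vanishes too, so the formula gives \<open>L\<^bsup>r+1\<^esup> D x = 0\<close>, and \<open>D x = 0\<close> by
  induction on the degree. For such \<open>x\<close> the formula turns \<open>L\<^sup>r x = 0\<close> into \<open>L\<^bsup>r-1\<^esup> x = 0\<close>, and so on down
  to \<open>x = 0\<close> (\<open>lefschetz_power_kernel\<close>). Thus \<open>L\<^sup>i\<close> is injective on degree \<open>-i\<close>, and bijective since complements
  give the pieces of degrees \<open>-i\<close> and \<open>i\<close> the same dimension.
\<close>

section \<open>Linear maps on the bigraded algebra\<close>

lemma linear_eq_on_tens_basis:
  fixes f g :: "'n::finite super \<Rightarrow> 'b::real_vector"
  assumes "linear f" "linear g"
    and "\<And>A B. f (tens (ext_basis A) (ext_basis B)) = g (tens (ext_basis A) (ext_basis B))"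
  shows "f x = g x"
proof -
  have "h x = (\<Sum>A\<in>UNIV. \<Sum>B\<in>UNIV. x $ (A, B) *\<^sub>R h (tens (ext_basis A) (ext_basis B)))"
    if "linear h" for h :: "'n super \<Rightarrow> 'b"
    by (subst super_expansion[of x]) (simp add: linear_sum[OF that] linear_scale[OF that])
  from this[OF assms(1)] this[OF assms(2)] show ?thesis by (simp only: assms(3))
qed

lemma linear_tens_map: "linear (tens_map f g)"
  unfolding tens_map_def
  by (auto intro!: linearI simp: algebra_simps sum.distrib scaleR_sum_right split_def)

lemma linear_lefschetz: "linear lefschetz"
  unfolding lefschetz_def by (intro linear_compose_sum ballI linear_tens_map)

lemma linear_super_perm: "linear (super_perm p)"
  unfolding super_perm_def by (rule linear_tens_map)

lemma subspace_super_piece: "subspace (super_piece d)"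
  unfolding super_piece_def by (rule subspace_span)

lemma linear_maps_super_piece:
  fixes f :: "'n::finite super \<Rightarrow> 'n super"
  assumes "linear f" "x \<in> super_piece d"
    and "\<And>A B. - int CARD('n) + int (card A + card B) = d \<Longrightarrow>
      f (tens (ext_basis A) (ext_basis B)) \<in> super_piece d'"
  shows "f x \<in> super_piece d'"
proof -
  have "f x = (\<Sum>A\<in>UNIV. \<Sum>B\<in>UNIV. x $ (A, B) *\<^sub>R f (tens (ext_basis A) (ext_basis B)))"
    by (subst super_expansion[of x]) (simp add: linear_sum[OF assms(1)] linear_scale[OF assms(1)])
  also have "\<dots> \<in> super_piece d'"
  proof (intro subspace_sum[OF subspace_super_piece])
    fix A B :: "'n set"
    show "x $ (A, B) *\<^sub>R f (tens (ext_basis A) (ext_basis B)) \<in> super_piece d'"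
    proof (cases "x $ (A, B) = 0")
      case False
      then have "- int CARD('n) + int (card A + card B) = d"
        using assms(2) unfolding super_piece_iff by blast
      then show ?thesis by (intro subspace_scale[OF subspace_super_piece] assms(3))
    qed (simp add: subspace_0[OF subspace_super_piece])
  qed
  finally show ?thesis .
qed

lemma tens_simps:
  "tens (c *\<^sub>R u) v = c *\<^sub>R tens u v" "tens u (c *\<^sub>R v) = c *\<^sub>R tens u v"
  "tens 0 v = 0" "tens u 0 = 0" "tens (- u) (- v) = tens u v"
  by (simp_all add: tens_def vec_eq_iff)

lemma tens_basis_in_super_piece:
  fixes A B :: "'n::finite set"
  shows "tens (ext_basis A) (ext_basis B) \<in> super_piece d \<longleftrightarrow>
    - int CARD('n) + int (card A + card B) = d"
  by (auto simp: super_piece_iff tens_nth ext_basis_nth)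

section \<open>The pairing\<close>

lemma ext_basis_wedge_top:
  "ext_basis_wedge A B $ UNIV = (if B = - A then (- 1) ^ crossings A (- A) else 0)"
  by (auto simp: ext_basis_wedge_def ext_basis_nth)

lemma top_coeff_super_mult:
  fixes x y :: "'n::{finite,linorder} super"
  shows "top_coeff (super_mult x y) = (\<Sum>A\<in>UNIV. \<Sum>B\<in>UNIV.
    (- 1) ^ (crossings A (- A) + crossings B (- B)) * x $ (A, B) * y $ (- A, - B))"
  by (simp add: top_coeff_def super_mult_def sum_UNIV_prod wedge_ext_basis tens_nth
      ext_basis_wedge_top power_add mult_ac if_distrib[of "\<lambda>c. c * _"] if_distrib[of "\<lambda>c. _ * c"]
      cong: if_cong)

lemma bilinear_super_mult: "bilinear super_mult"
  unfolding bilinear_def super_mult_def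
  by (auto intro!: linearI simp: algebra_simps sum.distrib scaleR_sum_right split_def)

lemma card_Compl_sum:
  fixes A B :: "'n::finite set"
  shows "int (card (- A) + card (- B)) = 2 * int CARD('n) - int (card A + card B)"
  using card_Un_disjoint[of A "- A"] card_Un_disjoint[of B "- B"] by (simp add: Compl_partition)

text \<open>
  The restriction to components of opposite degrees changes nothing: the coordinate \<open>(A, B)\<close> only
  meets the coordinate \<open>(- A, - B)\<close>, which has the opposite degree.
\<close>

lemma pairing_eq_top_coeff: "pairing x y = top_coeff (super_mult x y)"
proof -
  have "top_coeff (super_mult (super_component d x) (super_component (- d) y))
      = top_coeff (super_mult (super_component d x) y)" for d
    unfolding top_coeff_super_mult
    by (intro sum.cong refl) (auto simp: super_component_def card_Compl_sum simp del: of_nat_add)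
  moreover have "linear (\<lambda>x. top_coeff (super_mult x y))"
    unfolding top_coeff_super_mult
    by (auto intro!: linearI simp: algebra_simps sum.distrib sum_distrib_left)
  ultimately have "pairing x y
      = top_coeff (super_mult (\<Sum>d = - int CARD('a)..int CARD('a). super_component d x) y)"
    unfolding pairing_def by (simp only: linear_sum[where f = "\<lambda>x. top_coeff (super_mult x y)"])
  then show ?thesis by (simp only: sum_super_component[symmetric])
qed

lemmas pairing_expansion = trans[OF pairing_eq_top_coeff top_coeff_super_mult]

lemma bilinear_pairing: "bilinear pairing"
  unfolding bilinear_def pairing_expansion
  by (auto intro!: linearI simp: algebra_simps sum.distrib sum_distrib_left)

lemma pairing_graded:
  assumes "x \<in> super_piece i" "y \<in> super_piece j" "i \<noteq> - j"
  shows "pairing x y = 0"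
  unfolding pairing_expansion
proof (intro sum.neutral ballI)
  fix A B :: "'a set"
  have "x $ (A, B) = 0 \<or> y $ (- A, - B) = 0"
    using assms card_Compl_sum[of A B] unfolding super_piece_iff by fastforce
  then show "(- 1) ^ (crossings A (- A) + crossings B (- B)) * x $ (A, B) * y $ (- A, - B) = 0"
    by auto
qed

text \<open>
  Pairing with a basis vector reads off a single coordinate up to sign, so a vector in either radical
  has all coordinates zero.
\<close>

lemma pairing_basis_right:
  "pairing x (tens (ext_basis (- A)) (ext_basis (- B)))
    = (- 1) ^ (crossings A (- A) + crossings B (- B)) * x $ (A, B)"
  by (simp add: pairing_expansion tens_nth ext_basis_nth mult_ac
      if_distrib[of "\<lambda>c. c * _"] if_distrib[of "\<lambda>c. _ * c"] cong: if_cong)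

lemma pairing_basis_left:
  "pairing (tens (ext_basis A) (ext_basis B)) y
    = (- 1) ^ (crossings A (- A) + crossings B (- B)) * y $ (- A, - B)"
  by (simp add: pairing_expansion tens_nth ext_basis_nth mult_ac
      if_distrib[of "\<lambda>c. c * _"] if_distrib[of "\<lambda>c. _ * c"] cong: if_cong)

lemma pairing_nondegenerate_left:
  assumes "\<And>y. pairing x y = 0"
  shows "x = 0"
proof -
  have "x $ (A, B) = 0" for A B
    using pairing_basis_right[of x A B] assms by simp
  then show ?thesis by (simp add: vec_eq_iff)
qed

lemma pairing_nondegenerate_right:
  assumes "\<And>x. pairing x y = 0"
  shows "y = 0"
proof -
  have "y $ (A, B) = 0" for A B
    using pairing_basis_left[of "- A" "- B" y] assms by simp
  then show ?thesis by (simp add: vec_eq_iff)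
qed

section \<open>Equivariance\<close>

lemma linear_ext_perm: "linear (ext_perm p)"
  unfolding ext_perm_def
  by (auto intro!: linearI simp: algebra_simps sum.distrib scaleR_sum_right)

text \<open>
  The sign is that of the permutation sorting the word \<open>xs\<close>. Only its being a sign matters, since it
  will occur squared.
\<close>

lemma wedge_list_gen_distinct:
  assumes "distinct xs"
  shows "\<exists>m. wedge_list (map gen xs) = (- 1) ^ m *\<^sub>R ext_basis (set xs)"
  using assms
proof (induction xs)
  case Nil
  show ?case by (rule exI[of _ 0]) (simp add: wedge_list_def)
next
  case (Cons a xs)
  then obtain m where m: "wedge_list (map gen xs) = (- 1) ^ m *\<^sub>R ext_basis (set xs)" by auto
  have "wedge_list (map gen (a # xs)) = wedge (gen a) (wedge_list (map gen xs))"
    by (simp add: wedge_list_def)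
  then show ?case
    using Cons.prems
    by (intro exI[of _ "m + crossings {a} (set xs)"])
      (simp add: m wedge_simps wedge_ext_basis ext_basis_wedge_def power_add)
qed

lemma ext_perm_ext_basis:
  assumes "inj p"
  shows "\<exists>m. ext_perm p (ext_basis A) = (- 1) ^ m *\<^sub>R ext_basis (p ` A)"
proof -
  have "ext_perm p (ext_basis A) = wedge_list (map gen (map p (sorted_list_of_set A)))"
    by (simp add: ext_perm_def ext_basis_nth if_distrib[of "\<lambda>c. c *\<^sub>R _"] o_def cong: if_cong)
  moreover have "distinct (map p (sorted_list_of_set A))"
    using inj_on_subset[OF assms subset_UNIV] by (simp add: distinct_map)
  ultimately show ?thesis
    using wedge_list_gen_distinct[of "map p (sorted_list_of_set A)"] by simp
qed

lemma super_perm_tens: "super_perm p (tens u v) = tens (ext_perm p u) (ext_perm p v)"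
  by (simp add: super_perm_def tens_map_tens linear_ext_perm)

lemma super_perm_mult: "super_perm p (super_mult x y) = super_mult (super_perm p x) (super_perm p y)"
proof -
  note l = bilinear_super_mult[unfolded bilinear_def] linear_super_perm
  have 1: "linear (\<lambda>y. super_perm p (super_mult x y))" "linear (\<lambda>x. super_perm p (super_mult x y))"
    "linear (\<lambda>y. super_mult (super_perm p x) (super_perm p y))"
    "linear (\<lambda>x. super_mult (super_perm p x) (super_perm p y))" for x y :: "'a super"
    using linear_compose[of "super_mult x" "super_perm p"]
      linear_compose[of "\<lambda>x. super_mult x y" "super_perm p"]
      linear_compose[of "super_perm p" "super_mult (super_perm p x)"]
      linear_compose[of "super_perm p" "\<lambda>x. super_mult x (super_perm p y)"] l
    by (auto simp: o_def)
  show ?thesis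
    by (rule linear_eq_on_tens_basis[OF 1(2,4)], rule linear_eq_on_tens_basis[OF 1(1,3)])
      (simp add: super_perm_tens super_mult_tens ext_perm_wedge)
qed

text \<open>
  The sign of \<open>p\<close> appears once from the \<open>\<theta>\<close>-factor and once from the \<open>\<xi>\<close>-factor.
\<close>

lemma top_coeff_super_perm:
  assumes "p permutes UNIV"
  shows "top_coeff (super_perm p z) = top_coeff z"
proof (rule linear_eq_on_tens_basis[of "\<lambda>z. top_coeff (super_perm p z)" top_coeff])
  show lin: "linear top_coeff"
    unfolding top_coeff_def by (auto intro!: linearI)
  show "linear (\<lambda>z. top_coeff (super_perm p z))"
    using linear_compose[OF linear_super_perm lin] by (simp add: o_def)
  fix A B :: "'a set"
  have inj: "inj p" and surj: "surj p"
    using assms by (simp_all add: permutes_inj permutes_surj)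
  have img: "p ` A = UNIV \<longleftrightarrow> A = UNIV" for A
    using inj surj by (metis inj_image_eq_iff)
  obtain m k where "ext_perm p (ext_basis A) = (- 1) ^ m *\<^sub>R ext_basis (p ` A)"
    "ext_perm p (ext_basis B) = (- 1) ^ k *\<^sub>R ext_basis (p ` B)"
    using ext_perm_ext_basis[OF inj] by blast
  moreover from this have "(- 1) ^ m = ((- 1) ^ k :: real)" if "A = UNIV" "B = UNIV"
    using that surj by (metis ext_basis_nth mult.right_neutral real_scaleR_def vector_scaleR_component)
  ultimately show "top_coeff (super_perm p (tens (ext_basis A) (ext_basis B)))
      = top_coeff (tens (ext_basis A) (ext_basis B))"
    by (auto simp: top_coeff_def super_perm_tens tens_nth ext_basis_nth img)
qed

lemma pairing_super_perm:
  assumes "p permutes UNIV"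
  shows "pairing (super_perm p x) (super_perm p y) = pairing x y"
  by (simp add: pairing_eq_top_coeff super_perm_mult[symmetric] top_coeff_super_perm[OF assms])

lemma lefschetz_super_perm:
  assumes "p permutes UNIV"
  shows "lefschetz (super_perm p x) = super_perm p (lefschetz x)"
proof (rule linear_eq_on_tens_basis[of "\<lambda>x. lefschetz (super_perm p x)" "\<lambda>x. super_perm p (lefschetz x)"])
  show "linear (\<lambda>x. lefschetz (super_perm p x))" "linear (\<lambda>x. super_perm p (lefschetz x))"
    using linear_compose[OF linear_super_perm linear_lefschetz]
      linear_compose[OF linear_lefschetz linear_super_perm] by (simp_all add: o_def)
  fix A B :: "'a set"
  let ?g = "\<lambda>k. tens (wedge (gen k) (ext_perm p (ext_basis A))) (wedge (gen k) (ext_perm p (ext_basis B)))"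
  have "super_perm p (lefschetz (tens (ext_basis A) (ext_basis B))) = (\<Sum>k\<in>UNIV. ?g (p k))"
    by (simp add: lefschetz_tens linear_sum[OF linear_super_perm] super_perm_tens ext_perm_wedge
        ext_perm_gen)
  also have "\<dots> = (\<Sum>k\<in>UNIV. ?g k)"
    using sum.permute[OF assms, of ?g] by (simp add: o_def)
  finally show "lefschetz (super_perm p (tens (ext_basis A) (ext_basis B)))
      = super_perm p (lefschetz (tens (ext_basis A) (ext_basis B)))"
    by (simp add: super_perm_tens lefschetz_tens)
qed

section \<open>Contraction and the dual Lefschetz operator\<close>

text \<open>
  Interior product with the \<open>k\<close>-th dual generator: the adjoint of left multiplication by \<open>gen k\<close> when
  the \<open>ext_basis A\<close> are orthonormal. The sign is that of moving \<open>k\<close> to the front of the word \<open>A\<close>.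
\<close>

definition contract :: "'n::{finite,linorder} \<Rightarrow> 'n ext \<Rightarrow> 'n ext" where
  "contract k u = (\<Sum>A\<in>UNIV. u $ A *\<^sub>R
     (if k \<in> A then (- 1) ^ crossings {k} A *\<^sub>R ext_basis (A - {k}) else 0))"

definition dual_lefschetz :: "'n::{finite,linorder} super \<Rightarrow> 'n super" where
  "dual_lefschetz x = (\<Sum>k\<in>UNIV. tens_map (contract k) (contract k) x)"

lemma linear_contract: "linear (contract k)"
  unfolding contract_def
  by (auto intro!: linearI simp: algebra_simps sum.distrib scaleR_sum_right)

lemma linear_dual_lefschetz: "linear dual_lefschetz"
  unfolding dual_lefschetz_def by (intro linear_compose_sum ballI linear_tens_map)

lemma contract_ext_basis:
  "contract k (ext_basis A) = (if k \<in> A then (- 1) ^ crossings {k} A *\<^sub>R ext_basis (A - {k}) else 0)"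
  by (simp add: contract_def ext_basis_nth if_distrib[of "\<lambda>c. c *\<^sub>R _"] cong: if_cong)

lemma wedge_gen_ext_basis:
  "wedge (gen k) (ext_basis A)
    = (if k \<in> A then 0 else (- 1) ^ crossings {k} A *\<^sub>R ext_basis (insert k A))"
  by (simp add: wedge_ext_basis ext_basis_wedge_def)

lemma crossings_singleton: "crossings {k} A = card {a \<in> A. a < k}"
proof -
  have "{(a, b). a \<in> {k} \<and> b \<in> A \<and> b < a} = Pair k ` {a \<in> A. a < k}" by auto
  then show ?thesis by (simp add: crossings_def card_image inj_on_def)
qed

lemma crossings_singleton_insert:
  fixes A :: "'n::{finite,linorder} set"
  assumes "l \<notin> A"
  shows "crossings {k} (insert l A) = (if l < k then 1 else 0) + crossings {k} A"
proof -
  have "{a \<in> insert l A. a < k} = (if l < k then insert l {a \<in> A. a < k} else {a \<in> A. a < k})"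
    by auto
  then show ?thesis using assms by (simp add: crossings_singleton)
qed

text \<open>
  Both composites replace \<open>l\<close> by \<open>k\<close> in a basis vector. The signs differ by one transposition: exactly
  one of \<open>k < l\<close> and \<open>l < k\<close> holds, so only one of the two orders has to move the operator's index past
  the other one.
\<close>

lemma contract_wedge_anticommute:
  fixes k l :: "'n::{finite,linorder}"
  assumes "k \<noteq> l"
  shows "wedge (gen k) (contract l u) = - contract l (wedge (gen k) u)"
proof (rule linear_eq_on_ext_basis[of "\<lambda>u. wedge (gen k) (contract l u)" "\<lambda>u. - contract l (wedge (gen k) u)"])
  show "linear (\<lambda>u. wedge (gen k) (contract l u))" "linear (\<lambda>u. - contract l (wedge (gen k) u))"
    using linear_compose[OF linear_contract linear_wedge(1)]
      linear_compose_neg[OF linear_compose[OF linear_wedge(1) linear_contract]]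
    by (simp_all add: o_def)
  fix A :: "'n set"
  show "wedge (gen k) (contract l (ext_basis A)) = - contract l (wedge (gen k) (ext_basis A))"
  proof (cases "l \<in> A \<and> k \<notin> A")
    case True
    then obtain B where B: "A = insert l B" "l \<notin> B" "k \<notin> B"
      by (metis insert_iff mk_disjoint_insert)
    have "insert k (insert l B) - {l} = insert k B" "insert l B - {l} = B"
      using B assms by auto
    moreover have "l < k \<longleftrightarrow> \<not> k < l" using assms by auto
    ultimately show ?thesis
      using B assms
      by (simp add: contract_ext_basis wedge_gen_ext_basis wedge_simps linear_scale[OF linear_contract]
          crossings_singleton_insert insert_commute[of l k] mult_ac)
  next
    case False
    then show ?thesis
      using assms
      by (auto simp: contract_ext_basis wedge_gen_ext_basis wedge_simps linear_0[OF linear_contract]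
          linear_scale[OF linear_contract])
  qed
qed

text \<open>
  Together with the next lemma this is \<open>e\<^sub>k c\<^sub>k + c\<^sub>k e\<^sub>k = 1\<close>, in the stronger form that the two
  summands are the complementary projections to the basis vectors with and without \<open>k\<close>.
\<close>

lemma wedge_contract_ext_basis:
  fixes A :: "'n::{finite,linorder} set"
  shows "wedge (gen k) (contract k (ext_basis A)) = (if k \<in> A then ext_basis A else 0)"
proof (cases "k \<in> A")
  case True
  then obtain B where "A = insert k B" "k \<notin> B" by (meson mk_disjoint_insert)
  then show ?thesis
    by (simp add: contract_ext_basis wedge_gen_ext_basis wedge_simps crossings_singleton_insert
        flip: power_add)
qed (simp add: contract_ext_basis wedge_simps)

lemma contract_wedge_ext_basis:
  fixes A :: "'n::{finite,linorder} set"
  shows "contract k (wedge (gen k) (ext_basis A)) = (if k \<in> A then 0 else ext_basis A)"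
  by (auto simp: contract_ext_basis wedge_gen_ext_basis linear_scale[OF linear_contract]
      linear_0[OF linear_contract] crossings_singleton_insert simp flip: power_add)

lemma dual_lefschetz_tens:
  "dual_lefschetz (tens u v) = (\<Sum>k\<in>UNIV. tens (contract k u) (contract k v))"
  by (simp add: dual_lefschetz_def tens_map_tens linear_contract)

lemma lefschetz_commutator_basis:
  fixes A B :: "'n::{finite,linorder} set"
  shows "lefschetz (dual_lefschetz (tens (ext_basis A) (ext_basis B)))
      - dual_lefschetz (lefschetz (tens (ext_basis A) (ext_basis B)))
    = (real (card A) + real (card B) - real CARD('n)) *\<^sub>R tens (ext_basis A) (ext_basis B)"
proof -
  let ?t = "tens (ext_basis A) (ext_basis B)"
  define P where "P k l = tens (wedge (gen k) (contract l (ext_basis A)))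
    (wedge (gen k) (contract l (ext_basis B)))" for k l
  define Q where "Q k l = tens (contract l (wedge (gen k) (ext_basis A)))
    (contract l (wedge (gen k) (ext_basis B)))" for k l
  \<comment> \<open>Off the diagonal the two factors each contribute a minus sign; on it, of the two products of
    projections only the one matching the membership of \<open>k\<close> survives.\<close>
  have PQ: "P k l - Q k l
      = (if l = k then (of_bool (k \<in> A) + of_bool (k \<in> B) - 1) *\<^sub>R ?t else 0)" for k l
    by (auto simp: P_def Q_def contract_wedge_anticommute tens_simps wedge_contract_ext_basis
        contract_wedge_ext_basis)
  have "lefschetz (dual_lefschetz ?t) = (\<Sum>l\<in>UNIV. \<Sum>k\<in>UNIV. P k l)"
    by (simp add: dual_lefschetz_tens linear_sum[OF linear_lefschetz] lefschetz_tens P_def)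
  also have "\<dots> = (\<Sum>k\<in>UNIV. \<Sum>l\<in>UNIV. P k l)" by (rule sum.swap)
  finally have "lefschetz (dual_lefschetz ?t) - dual_lefschetz (lefschetz ?t)
      = (\<Sum>k\<in>UNIV. \<Sum>l\<in>UNIV. P k l - Q k l)"
    by (simp add: dual_lefschetz_tens linear_sum[OF linear_dual_lefschetz] lefschetz_tens Q_def
        sum_subtractf)
  also have "\<dots> = (\<Sum>k\<in>UNIV. (of_bool (k \<in> A) + of_bool (k \<in> B) - 1) *\<^sub>R ?t)"
    by (simp add: PQ)
  also have "\<dots> = (\<Sum>k\<in>UNIV. of_bool (k \<in> A) + of_bool (k \<in> B) - 1) *\<^sub>R ?t"
    by (simp add: scaleR_sum_left)
  also have "(\<Sum>k\<in>UNIV. of_bool (k \<in> A) + of_bool (k \<in> B) - 1)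
      = real (card A) + real (card B) - real CARD('n)"
    by (simp add: sum.distrib sum_subtractf of_bool_def sum.If_cases)
  finally show ?thesis .
qed

text \<open>
  The commutator is diagonal in the basis with the degrees as eigenvalues, hence scalar on each piece.
\<close>

lemma lefschetz_commutator:
  fixes x :: "'n::{finite,linorder} super"
  assumes "x \<in> super_piece d"
  shows "dual_lefschetz (lefschetz x) = lefschetz (dual_lefschetz x) - of_int d *\<^sub>R x"
proof -
  define H :: "'n super \<Rightarrow> 'n super" where
    "H x = (\<chi> AB. (real (card (fst AB)) + real (card (snd AB)) - real CARD('n)) * x $ AB)" for x
  have "lefschetz (dual_lefschetz x) - dual_lefschetz (lefschetz x) = H x"
  proof (rule linear_eq_on_tens_basis[of "\<lambda>x. lefschetz (dual_lefschetz x) - dual_lefschetz (lefschetz x)"])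
    show "linear (\<lambda>x :: 'n super. lefschetz (dual_lefschetz x) - dual_lefschetz (lefschetz x))"
      using linear_compose_sub[OF linear_compose[OF linear_dual_lefschetz linear_lefschetz]
          linear_compose[OF linear_lefschetz linear_dual_lefschetz]] by (simp add: o_def)
    show "linear H"
      unfolding H_def by (auto intro!: linearI simp: vec_eq_iff algebra_simps)
    show "lefschetz (dual_lefschetz (tens (ext_basis A) (ext_basis B)))
        - dual_lefschetz (lefschetz (tens (ext_basis A) (ext_basis B)))
        = H (tens (ext_basis A) (ext_basis B))" for A B
      unfolding lefschetz_commutator_basis
      by (auto simp: H_def vec_eq_iff tens_nth ext_basis_nth)
  qed
  moreover have "H x = of_int d *\<^sub>R x"
    using assms by (force simp: H_def vec_eq_iff super_piece_iff)
  ultimately show ?thesis by (simp add: algebra_simps)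
qed

lemma lefschetz_super_piece:
  assumes "x \<in> super_piece d"
  shows "lefschetz x \<in> super_piece (d + 2)"
  using linear_lefschetz assms
proof (rule linear_maps_super_piece)
  fix A B :: "'a set"
  assume "- int CARD('a) + int (card A + card B) = d"
  then show "lefschetz (tens (ext_basis A) (ext_basis B)) \<in> super_piece (d + 2)"
    by (auto simp: lefschetz_tens wedge_gen_ext_basis tens_simps tens_basis_in_super_piece
        intro!: subspace_sum[OF subspace_super_piece] subspace_0[OF subspace_super_piece]
          subspace_scale[OF subspace_super_piece])
qed

lemma dual_lefschetz_super_piece:
  assumes "x \<in> super_piece d"
  shows "dual_lefschetz x \<in> super_piece (d - 2)"
  using linear_dual_lefschetz assms
proof (rule linear_maps_super_piece)
  fix A B :: "'a set"
  assume d: "- int CARD('a) + int (card A + card B) = d"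
  have "tens (contract k (ext_basis A)) (contract k (ext_basis B)) \<in> super_piece (d - 2)" for k
  proof (cases "k \<in> A \<and> k \<in> B")
    case True
    then have "card A = Suc (card (A - {k}))" "card B = Suc (card (B - {k}))"
      by (simp_all only: card_Suc_Diff1 finite)
    with True d show ?thesis
      by (auto simp: contract_ext_basis tens_simps tens_basis_in_super_piece simp del: card_Diff_insert card_Diff_singleton
          intro!: subspace_scale[OF subspace_super_piece])
  qed (auto simp: contract_ext_basis tens_simps subspace_0[OF subspace_super_piece])
  then show "dual_lefschetz (tens (ext_basis A) (ext_basis B)) \<in> super_piece (d - 2)"
    by (auto simp: dual_lefschetz_tens intro!: subspace_sum[OF subspace_super_piece])
qed

section \<open>Hard Lefschetz\<close>

lemma lefschetz_power_super_piece:
  assumes "x \<in> super_piece d"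
  shows "(lefschetz ^^ r) x \<in> super_piece (d + 2 * int r)"
proof (induction r)
  case (Suc r)
  show ?case using lefschetz_super_piece[OF Suc] by (simp add: algebra_simps)
qed (simp add: assms)

lemma linear_lefschetz_power: "linear (lefschetz ^^ r)"
proof (induction r)
  case (Suc r)
  show ?case using linear_compose[OF Suc linear_lefschetz] by (simp add: o_def)
qed (simp add: linear_id[unfolded id_def])

text \<open>
  Moving \<open>D\<close> past \<open>r + 1\<close> copies of \<open>L\<close> subtracts the degrees \<open>d, d + 2, \<dots>, d + 2r\<close> that it meets on the
  way; their sum is \<open>(r + 1)(d + r)\<close>.
\<close>

lemma dual_lefschetz_lefschetz_power:
  assumes "x \<in> super_piece d"
  shows "dual_lefschetz ((lefschetz ^^ Suc r) x)
    = (lefschetz ^^ Suc r) (dual_lefschetz x)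
      - (real (Suc r) * (of_int d + real r)) *\<^sub>R (lefschetz ^^ r) x"
proof (induction r)
  case 0
  show ?case using lefschetz_commutator[OF assms] by simp
next
  case (Suc r)
  let ?y = "(lefschetz ^^ Suc r) x"
  have "dual_lefschetz (lefschetz ?y)
      = lefschetz (dual_lefschetz ?y) - (of_int d + 2 * real (Suc r)) *\<^sub>R ?y"
    using lefschetz_commutator[OF lefschetz_power_super_piece[OF assms], of "Suc r"] by simp
  also have "lefschetz (dual_lefschetz ?y) = (lefschetz ^^ Suc (Suc r)) (dual_lefschetz x)
      - (real (Suc r) * (of_int d + real r)) *\<^sub>R ?y"
    unfolding Suc by (simp add: linear_diff[OF linear_lefschetz] linear_scale[OF linear_lefschetz])
  finally have "dual_lefschetz ((lefschetz ^^ Suc (Suc r)) x)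
      = (lefschetz ^^ Suc (Suc r)) (dual_lefschetz x)
        - (real (Suc r) * (of_int d + real r) + (of_int d + 2 * real (Suc r))) *\<^sub>R ?y"
    by (simp only: funpow.simps(2) o_apply scaleR_add_left diff_diff_eq)
  also have "real (Suc r) * (of_int d + real r) + (of_int d + 2 * real (Suc r))
      = real (Suc (Suc r)) * (of_int d + real (Suc r))"
    by (simp add: algebra_simps)
  finally show ?case .
qed

lemma super_piece_below:
  fixes x :: "'n::finite super"
  assumes "x \<in> super_piece d" "d < - int CARD('n)"
  shows "x = 0"
  using assms by (force simp: super_piece_iff vec_eq_iff)

text \<open>
  The statement covers all \<open>r \<le> - d\<close>, and not only \<open>r = - d\<close>, because the induction passes from
  \<open>(d, r)\<close> to \<open>(d - 2, r + 1)\<close>.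
\<close>

lemma lefschetz_power_kernel:
  fixes x :: "'n::{finite,linorder} super"
  assumes "x \<in> super_piece d" "d + int r \<le> 0" "(lefschetz ^^ r) x = 0"
  shows "x = 0"
  using assms
proof (induction "nat (d + int CARD('n) + 1)" arbitrary: d x r rule: less_induct)
  case less
  show ?case
  proof (cases "d < - int CARD('n)")
    case True
    then show ?thesis using less.prems(1) super_piece_below by blast
  next
    case False
    have "(lefschetz ^^ Suc r) (dual_lefschetz x) = 0"
    proof -
      have "(lefschetz ^^ Suc r) x = 0"
        using less.prems(3) by (simp add: linear_0[OF linear_lefschetz])
      then show ?thesis
        using dual_lefschetz_lefschetz_power[OF less.prems(1), of r] less.prems(3)
        by (simp add: linear_0[OF linear_dual_lefschetz])
    qed
    then have primitive: "dual_lefschetz x = 0"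
      using less.hyps[of "d - 2" "dual_lefschetz x" "Suc r"] False less.prems
        dual_lefschetz_super_piece[OF less.prems(1)] by simp
    \<comment> \<open>As \<open>x\<close> is primitive, applying \<open>D\<close> to \<open>L\<^bsup>r+1\<^esup> x = 0\<close> leaves a multiple of \<open>L\<^sup>r x\<close>, whose coefficient
      is non-zero because \<open>d + r < 0\<close>.\<close>
    show ?thesis
      using less.prems(2,3)
    proof (induction r)
      case (Suc r)
      have "(real (Suc r) * (of_int d + real r)) *\<^sub>R (lefschetz ^^ r) x = 0"
        using dual_lefschetz_lefschetz_power[OF less.prems(1), of r] Suc.prems(2) primitive
        by (simp add: linear_0[OF linear_dual_lefschetz] linear_0[OF linear_lefschetz]
            linear_0[OF linear_lefschetz_power])
      moreover have "of_int d + real r < 0" using Suc.prems(1) by linarith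
      ultimately have "(lefschetz ^^ r) x = 0" by simp
      then show ?case using Suc by simp
    qed simp
  qed
qed

lemma dim_super_piece_uminus:
  "dim (super_piece (- d) :: 'n::finite super set) = dim (super_piece d :: 'n super set)"
proof -
  define flip :: "'n super \<Rightarrow> 'n super" where "flip x = (\<chi> AB. x $ (- fst AB, - snd AB))" for x
  have lin: "linear flip" unfolding flip_def by (auto intro!: linearI simp: vec_eq_iff)
  have invol: "flip (flip x) = x" for x by (simp add: flip_def vec_eq_iff)
  have sub: "flip x \<in> super_piece (- d)" if "x \<in> super_piece d" for x d
    unfolding super_piece_iff
  proof (intro allI impI)
    fix A B :: "'n set"
    assume "flip x $ (A, B) \<noteq> 0"
    then have "- int CARD('n) + int (card (- A) + card (- B)) = d"
      using that by (simp add: flip_def super_piece_iff)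
    then show "- int CARD('n) + int (card A + card B) = - d"
      using card_Compl_sum[of A B] by linarith
  qed
  have "flip ` super_piece d = super_piece (- d)"
    using sub[of _ d] sub[of _ "- d"] invol by (force intro: rev_image_eqI)
  moreover have "inj flip" using invol by (metis injI)
  ultimately show ?thesis using dim_image_eq[OF lin, of "super_piece d"] by (metis inj_on_subset subset_UNIV)
qed

lemma lefschetz_power_bij:
  "bij_betw (lefschetz ^^ i) (super_piece (- int i)) (super_piece (int i) :: 'n::{finite,linorder} super set)"
proof -
  let ?S = "super_piece (- int i) :: 'n super set" and ?T = "super_piece (int i) :: 'n super set"
  have inj: "inj_on (lefschetz ^^ i) ?S"
    using lefschetz_power_kernel[of _ "- int i" i]
    by (subst linear_inj_on_iff_eq_0[OF linear_lefschetz_power subspace_super_piece]) auto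
  have sub: "(lefschetz ^^ i) ` ?S \<subseteq> ?T"
    using lefschetz_power_super_piece[of _ "- int i" i] by auto
  have "span ?S = ?S" using subspace_super_piece by (simp only: span_eq_iff)
  then have "dim ((lefschetz ^^ i) ` ?S) = dim ?T"
    using dim_image_eq[OF linear_lefschetz_power, of i ?S] inj dim_super_piece_uminus[of "int i"]
    by (simp only:)
  then have "(lefschetz ^^ i) ` ?S = ?T"
    using subspace_dim_equal[OF linear_subspace_image[OF linear_lefschetz_power subspace_super_piece]
        subspace_super_piece sub] by simp
  with inj show ?thesis by (simp add: bij_betw_def)
qed

theorem theorem16:
  shows
    "(bilinear (pairing :: 'n::{finite,linorder} super \<Rightarrow> 'n super \<Rightarrow> real) \<and>
      (\<forall>\<sigma>. \<sigma> permutes (UNIV :: 'n set) \<longrightarrow>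
        (\<forall>x y. pairing (super_perm \<sigma> x) (super_perm \<sigma> y) = pairing x y)) \<and>
      (\<forall>i j. \<forall>x \<in> super_piece i. \<forall>y \<in> super_piece j.
        i \<noteq> - j \<longrightarrow> pairing x (y :: 'n super) = 0) \<and>
      (\<forall>x :: 'n super. (\<forall>y. pairing x y = 0) \<longrightarrow> x = 0) \<and>
      (\<forall>y :: 'n super. (\<forall>x. pairing x y = 0) \<longrightarrow> y = 0))
     \<and>
     (linear (lefschetz :: 'n super \<Rightarrow> 'n super) \<and>
      (\<forall>i. (lefschetz :: 'n super \<Rightarrow> 'n super) ` super_piece i \<subseteq> super_piece (i + 2)) \<and>
      (\<forall>\<sigma>. \<sigma> permutes (UNIV :: 'n set) \<longrightarrow>
        (\<forall>x. lefschetz (super_perm \<sigma> x) = super_perm \<sigma> (lefschetz x))) \<and>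
      (\<forall>i::nat. linear ((lefschetz :: 'n super \<Rightarrow> 'n super) ^^ i) \<and>
        bij_betw ((lefschetz :: 'n super \<Rightarrow> 'n super) ^^ i)
          (super_piece (- int i)) (super_piece (int i))))"
  by (intro conjI allI ballI impI image_subsetI bilinear_pairing linear_lefschetz
      linear_lefschetz_power lefschetz_power_bij lefschetz_super_piece)
    (auto intro: pairing_super_perm pairing_graded pairing_nondegenerate_left
      pairing_nondegenerate_right lefschetz_super_perm)

end
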